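(* Let $2\le n\le7$, let $\Omega\subset\mathbb R^n$ be open, and let $a:(0,\infty)\to(0,\infty)$ be such that the function $b$ given by $b(t)=t\,a(t)$ for $t>0$, $b(0)=0$, satisfies $b\in C^1([0,\infty))$, and $$-\frac{8-n}{16}<i_a\le s_a<\infty.$$ Then there exist positive constants $c_1$ and $c_2$, depending only on $i_a$, $s_a$ and $n$, such that for every $u\in C^3(\Omega;\mathbb R^n)$ $$|\mathrm{div}(\mathcal A(\mathcal E u))|^2\ge c_1\,a^2(|\mathcal E u|)\,|\nabla\mathcal E u|^2+c_2\,\mathrm{div}\Big(a^2(|\mathcal E u|)\big((\Delta u)^T\mathcal E u-\tfrac12\nabla(|\mathcal E u|^2)\big)\Big)\quad\text{in }\Omega.$$
   Context: $i_a=\inf_{t>0}\frac{t\,a'(t)}{a(t)}$ and $s_a=\sup_{t>0}\frac{t\,a'(t)}{a(t)}$. The function $a$ is extended continuously to $0$ by $a(0)=b'(0)$. The map $\mathcal A:\mathbb R^{n\times n}\to\mathbb R^{n\times n}$ is $\mathcal A(\xi)=a(|\xi|)\xi$ if $\xi\ne0$, $\mathcal A(0)=0$. $\mathcal E u=\tfrac12(\nabla u+(\nabla u)^T)$; $|\cdot|$ is the Euclidean norm of vectors, matrices (Frobenius) and third-order tensors; $a^2(t)=(a(t))^2$. $\Delta u$ is the column vector of componentwise Laplacians; gradients of scalar functions are row vectors; the divergence of a row vector field is the usual one, and the divergence of a matrix field is taken row by row. *)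

theory Defs
  imports "HOL-Analysis.Analysis"
begin

section \<open>The scalar function \<open>a\<close>, its indices, and the map \<open>\<A>\<close>\<close>

text \<open>
  A function \<open>a : (0,\<infinity>) \<rightarrow> (0,\<infinity>)\<close> is represented by a total function of type
  \<open>real \<Rightarrow> real\<close>; nothing below depends on its values at arguments \<open>\<le> 0\<close>.
\<close>

definition b_fun :: "(real \<Rightarrow> real) \<Rightarrow> real \<Rightarrow> real" where
  "b_fun a t = (if t > 0 then t * a t else 0)"

text \<open>The derivative at \<open>0\<close> is one-sided.\<close>

definition C1_on_nonneg :: "(real \<Rightarrow> real) \<Rightarrow> bool" where
  "C1_on_nonneg f \<longleftrightarrow>
     (\<exists>f'. (\<forall>t\<ge>0. (f has_real_derivative f' t) (at t within {0..})) \<and> continuous_on {0..} f')"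

definition ext0 :: "(real \<Rightarrow> real) \<Rightarrow> real \<Rightarrow> real" where
  "ext0 a t = (if t > 0 then a t else vector_derivative (b_fun a) (at 0 within {0..}))"

text \<open>
  The indices are taken in the extended reals, so that the infimum and the supremum are
  meaningful for unbounded families as well.
\<close>

definition lower_index :: "(real \<Rightarrow> real) \<Rightarrow> ereal" where
  "lower_index a = (INF t\<in>{0<..}. ereal (t * deriv a t / a t))"

definition upper_index :: "(real \<Rightarrow> real) \<Rightarrow> ereal" where
  "upper_index a = (SUP t\<in>{0<..}. ereal (t * deriv a t / a t))"

text \<open>The norm of \<^typ>\<open>real^'n^'n\<close> is the Frobenius norm.\<close>

definition A_map :: "(real \<Rightarrow> real) \<Rightarrow> real^'n^'n \<Rightarrow> real^'n^'n" where
  "A_map a \<xi> = (if \<xi> = 0 then 0 else a (norm \<xi>) *\<^sub>R \<xi>)"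


section \<open>Differential operators\<close>

text \<open>
  \<open>C_k k S f\<close>: on the open set \<open>S\<close>, \<open>f\<close> is \<open>k\<close> times continuously differentiable,
  formulated with directional derivatives.
\<close>

primrec C_k :: "nat \<Rightarrow> 'a::real_normed_vector set \<Rightarrow> ('a \<Rightarrow> 'b::real_normed_vector) \<Rightarrow> bool" where
  "C_k 0 S f \<longleftrightarrow> continuous_on S f"
| "C_k (Suc k) S f \<longleftrightarrow>
     (\<forall>x\<in>S. f differentiable (at x)) \<and> (\<forall>v. C_k k S (\<lambda>x. frechet_derivative f (at x) v))"

definition grad :: "(real^'n \<Rightarrow> real) \<Rightarrow> real^'n \<Rightarrow> real^'n" where
  "grad f x = (\<chi> j. frechet_derivative f (at x) (axis j 1))"

text \<open>
  The entry \<open>(i, j)\<close> of \<open>jacobian V (at x)\<close> is the \<open>j\<close>-th partial derivative of the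
  \<open>i\<close>-th component of \<open>V\<close>.
\<close>

definition divergence :: "(real^'n \<Rightarrow> real^'n) \<Rightarrow> real^'n \<Rightarrow> real" where
  "divergence V x = trace (jacobian V (at x))"

definition mat_divergence :: "(real^'n \<Rightarrow> real^'n^'n) \<Rightarrow> real^'n \<Rightarrow> real^'n" where
  "mat_divergence M x = (\<chi> i. divergence (\<lambda>y. M y $ i) x)"

definition laplacian :: "(real^'n \<Rightarrow> real) \<Rightarrow> real^'n \<Rightarrow> real" where
  "laplacian f x = divergence (grad f) x"

definition vec_laplacian :: "(real^'n \<Rightarrow> real^'n) \<Rightarrow> real^'n \<Rightarrow> real^'n" where
  "vec_laplacian u x = (\<chi> i. laplacian (\<lambda>y. u y $ i) x)"

definition sym_grad :: "(real^'n \<Rightarrow> real^'n) \<Rightarrow> real^'n \<Rightarrow> real^'n^'n" where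
  "sym_grad u x = (1/2) *\<^sub>R (jacobian u (at x) + transpose (jacobian u (at x)))"

text \<open>
  The third-order tensor whose entry \<open>(i, j, k)\<close> is the \<open>k\<close>-th partial derivative of the
  entry \<open>(i, j)\<close> of \<open>M\<close>; the norm of its type is the Euclidean norm of all entries.
\<close>

definition mat_grad :: "(real^'n \<Rightarrow> real^'n^'n) \<Rightarrow> real^'n \<Rightarrow> real^'n^'n^'n" where
  "mat_grad M x = (\<chi> i. jacobian (\<lambda>y. M y $ i) (at x))"

end

theory Submission
  imports Defs
begin

text \<open>
  Write \<open>E\<close> for the symmetric gradient, \<open>N = E / |E|\<close>, \<open>T\<^sub>k\<close> for the \<open>k\<close>-th partial derivative
  of \<open>E\<close>, \<open>p\<^sub>k = N \<bullet> T\<^sub>k\<close>, \<open>d = div E\<close>, \<open>\<tau> = \<nabla>(tr E)\<close> and \<open>\<theta> = t a'(t) / a(t)\<close> at \<open>t = |E|\<close>.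
  The Laplacian of \<open>u\<close> is \<open>L = 2 d - \<tau>\<close>, and the third derivatives of \<open>u\<close> cancel on the right-hand
  side. Divided by \<open>a\<^sup>2(|E|)\<close>, the left-hand side is \<open>|q|\<^sup>2\<close> with \<open>q = d + \<theta> N p\<close>, and the
  divergence term is
  \<open>L \<bullet> d - |T|\<^sup>2 + 2 \<theta> (L \<bullet> N p - |p|\<^sup>2)
    = 2 |q|\<^sup>2 - \<tau> \<bullet> q - |T|\<^sup>2 - 2 \<theta> |p|\<^sup>2 - 2 \<theta>\<^sup>2 |N p|\<^sup>2 - \<theta> \<tau> \<bullet> N p\<close>.
  Completing the square gives \<open>2 \<theta>\<^sup>2 |N p|\<^sup>2 + \<theta> \<tau> \<bullet> N p \<ge> - |\<tau>|\<^sup>2 / 8\<close>, so with \<open>|\<tau>|\<^sup>2 \<le> n |T|\<^sup>2\<close> and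
  \<open>|p| \<le> |T|\<close> the terms without \<open>q\<close> are at most \<open>- \<delta> |T|\<^sup>2\<close>, where
  \<open>\<delta> = 1 - n / 8 + 2 min(i\<^sub>a, 0)\<close>; the hypothesis on \<open>i\<^sub>a\<close> together with \<open>n \<le> 7\<close> says exactly that \<open>\<delta> > 0\<close>.
  The terms with \<open>q\<close> are absorbed by \<open>|q|\<^sup>2\<close> if \<open>c\<^sub>2\<close> is small. Where \<open>E\<close> vanishes, the same
  formulas hold with \<open>\<theta> = 0\<close>.
\<close>

section \<open>Symmetry of second derivatives\<close>

text \<open>The second difference is a first difference in direction \<open>v\<close> of a first
  difference in direction \<open>w\<close>, so the mean value theorem applies once in each
  direction.\<close>

lemma second_difference_mean_value:
  fixes f :: "'a::real_normed_vector \<Rightarrow> real"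
  assumes h: "h > 0"
    and box: "\<And>s t. \<lbrakk>0 \<le> s; s \<le> h; 0 \<le> t; t \<le> h\<rbrakk> \<Longrightarrow> x + s *\<^sub>R v + t *\<^sub>R w \<in> S"
    and F: "\<And>y. y \<in> S \<Longrightarrow> (f has_derivative F y) (at y)"
    and G: "\<And>y. y \<in> S \<Longrightarrow> ((\<lambda>z. F z v) has_derivative G y) (at y)"
  obtains s t where "0 \<le> s" "s \<le> h" "0 \<le> t" "t \<le> h"
    and "f (x + h *\<^sub>R v + h *\<^sub>R w) - f (x + h *\<^sub>R v) - f (x + h *\<^sub>R w) + f x
           = h\<^sup>2 * G (x + s *\<^sub>R v + t *\<^sub>R w) w"
proof -
  have dv: "((\<lambda>s. f (x + s *\<^sub>R v + t *\<^sub>R w)) has_real_derivative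
      F (x + s *\<^sub>R v + t *\<^sub>R w) v) (at s)"
    if "0 \<le> s" "s \<le> h" "0 \<le> t" "t \<le> h" for s t
  proof -
    have "((\<lambda>s. f (x + s *\<^sub>R v + t *\<^sub>R w)) has_derivative
        (\<lambda>r. F (x + s *\<^sub>R v + t *\<^sub>R w) (r *\<^sub>R v))) (at s)"
      by (rule has_derivative_compose[where g = f and f = "\<lambda>s. x + s *\<^sub>R v + t *\<^sub>R w", OF _ F[OF box[OF that]]])
        (auto intro!: derivative_eq_intros)
    moreover have "linear (F (x + s *\<^sub>R v + t *\<^sub>R w))"
      using F[OF box[OF that]] has_derivative_linear by blast
    ultimately show ?thesis
      by (simp add: has_field_derivative_def linear_cmul mult_commute_abs)
  qed
  have dw: "((\<lambda>t. F (x + s *\<^sub>R v + t *\<^sub>R w) v) has_real_derivative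
      G (x + s *\<^sub>R v + t *\<^sub>R w) w) (at t)"
    if "0 \<le> s" "s \<le> h" "0 \<le> t" "t \<le> h" for s t
  proof -
    have "((\<lambda>t. F (x + s *\<^sub>R v + t *\<^sub>R w) v) has_derivative
        (\<lambda>r. G (x + s *\<^sub>R v + t *\<^sub>R w) (r *\<^sub>R w))) (at t)"
      by (rule has_derivative_compose[where g = "\<lambda>z. F z v"
            and f = "\<lambda>t. x + s *\<^sub>R v + t *\<^sub>R w", OF _ G[OF box[OF that]]])
        (auto intro!: derivative_eq_intros)
    moreover have "linear (G (x + s *\<^sub>R v + t *\<^sub>R w))"
      using G[OF box[OF that]] has_derivative_linear by blast
    ultimately show ?thesis
      by (simp add: has_field_derivative_def linear_cmul mult_commute_abs)
  qed
  \<comment> \<open>The zero multiples stay unsimplified so that \<open>dv\<close> matches with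
    \<open>s = 0\<close> or \<open>t = 0\<close>.\<close>
  have "\<exists>s. 0 < s \<and> s < h \<and>
    (f (x + h *\<^sub>R v + h *\<^sub>R w) - f (x + h *\<^sub>R v + 0 *\<^sub>R w))
      - (f (x + 0 *\<^sub>R v + h *\<^sub>R w) - f (x + 0 *\<^sub>R v + 0 *\<^sub>R w))
      = (h - 0) * (F (x + s *\<^sub>R v + h *\<^sub>R w) v - F (x + s *\<^sub>R v + 0 *\<^sub>R w) v)"
    by (rule MVT2[OF h]) (use h in \<open>auto intro!: DERIV_diff dv simp del: scaleR_zero_left\<close>)
  then obtain s where s: "0 < s" "s < h" and es:
    "f (x + h *\<^sub>R v + h *\<^sub>R w) - f (x + h *\<^sub>R v) - (f (x + h *\<^sub>R w) - f x)
      = h * (F (x + s *\<^sub>R v + h *\<^sub>R w) v - F (x + s *\<^sub>R v + 0 *\<^sub>R w) v)"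
    by auto
  have "\<exists>t. 0 < t \<and> t < h \<and>
    F (x + s *\<^sub>R v + h *\<^sub>R w) v - F (x + s *\<^sub>R v + 0 *\<^sub>R w) v
      = (h - 0) * G (x + s *\<^sub>R v + t *\<^sub>R w) w"
    by (rule MVT2[OF h]) (use s in \<open>auto intro!: dw\<close>)
  then obtain t where t: "0 < t" "t < h" and et:
    "F (x + s *\<^sub>R v + h *\<^sub>R w) v - F (x + s *\<^sub>R v + 0 *\<^sub>R w) v
      = h * G (x + s *\<^sub>R v + t *\<^sub>R w) w"
    by auto
  show ?thesis
    using that[of s t] s t es et by (simp add: power2_eq_square)
qed

text \<open>The second difference is symmetric in \<open>v\<close> and \<open>w\<close>. Evaluated
  in both orders, it gives \<open>h\<^sup>2\<close> times a value of \<open>G\<close> and of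
  \<open>H\<close> at points near \<open>x\<close>, and continuity at \<open>x\<close> compares
  these with the values at \<open>x\<close>.\<close>

lemma mixed_derivatives_commute:
  fixes f :: "'a::real_normed_vector \<Rightarrow> real"
  assumes S: "open S" "x \<in> S"
    and F: "\<And>y. y \<in> S \<Longrightarrow> (f has_derivative F y) (at y)"
    and G: "\<And>y. y \<in> S \<Longrightarrow> ((\<lambda>z. F z v) has_derivative G y) (at y)"
    and H: "\<And>y. y \<in> S \<Longrightarrow> ((\<lambda>z. F z w) has_derivative H y) (at y)"
    and cG: "isCont (\<lambda>y. G y w) x" and cH: "isCont (\<lambda>y. H y v) x"
  shows "G x w = H x v"
proof -
  have "\<bar>G x w - H x v\<bar> \<le> e" if "e > 0" for e
  proof -
    obtain d1 where d1: "d1 > 0" "\<And>y. dist y x < d1 \<Longrightarrow> \<bar>G y w - G x w\<bar> < e / 2"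
      using cG \<open>e > 0\<close> unfolding continuous_at_eps_delta dist_real_def by (meson half_gt_zero)
    obtain d2 where d2: "d2 > 0" "\<And>y. dist y x < d2 \<Longrightarrow> \<bar>H y v - H x v\<bar> < e / 2"
      using cH \<open>e > 0\<close> unfolding continuous_at_eps_delta dist_real_def by (meson half_gt_zero)
    obtain d3 where d3: "d3 > 0" "\<And>y. dist y x < d3 \<Longrightarrow> y \<in> S"
      using S by (meson open_dist)
    define d where "d = min d1 (min d2 d3)"
    \<comment> \<open>The parallelogram with sides \<open>h v\<close> and \<open>h w\<close> then
      lies within distance \<open>d\<close> of \<open>x\<close>; the summand \<open>1\<close> covers
      \<open>v = w = 0\<close>.\<close>
    define h where "h = d / (1 + norm v + norm w)"
    have n: "1 + norm v + norm w > 0"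
      by (simp add: add_pos_nonneg)
    have h: "h > 0"
      using d1 d2 d3 n by (simp add: h_def d_def)
    have near: "dist (x + s *\<^sub>R v + t *\<^sub>R w) x < d"
      if "0 \<le> s" "s \<le> h" "0 \<le> t" "t \<le> h" for s t
    proof -
      have "dist (x + s *\<^sub>R v + t *\<^sub>R w) x \<le> s * norm v + t * norm w"
        using that norm_triangle_ineq[of "s *\<^sub>R v" "t *\<^sub>R w"]
        by (simp add: dist_norm add.assoc)
      also have "\<dots> \<le> h * norm v + h * norm w"
        using that by (intro add_mono mult_right_mono) auto
      also have "\<dots> < h * (1 + norm v + norm w)"
        using h by (simp add: distrib_left)
      also have "\<dots> = d"
        using n by (simp add: h_def)
      finally show ?thesis .
    qed
    let ?D = "f (x + h *\<^sub>R v + h *\<^sub>R w) - f (x + h *\<^sub>R v) - f (x + h *\<^sub>R w) + f x"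
    have in_S: "x + s *\<^sub>R v + t *\<^sub>R w \<in> S"
      if "0 \<le> s" "s \<le> h" "0 \<le> t" "t \<le> h" for s t
      using near[OF that] by (intro d3(2)) (simp add: d_def)
    have in_S': "x + s *\<^sub>R w + t *\<^sub>R v \<in> S"
      if "0 \<le> s" "s \<le> h" "0 \<le> t" "t \<le> h" for s t
      using in_S[OF that(3,4,1,2)] by (simp add: algebra_simps)
    obtain s t where 1: "0 \<le> s" "s \<le> h" "0 \<le> t" "t \<le> h"
      "?D = h\<^sup>2 * G (x + s *\<^sub>R v + t *\<^sub>R w) w"
      by (rule second_difference_mean_value[where f = f and F = F and G = G, OF h in_S F G])
    obtain s' t' where 2: "0 \<le> s'" "s' \<le> h" "0 \<le> t'" "t' \<le> h"
      "f (x + h *\<^sub>R w + h *\<^sub>R v) - f (x + h *\<^sub>R w) - f (x + h *\<^sub>R v) + f x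
         = h\<^sup>2 * H (x + s' *\<^sub>R w + t' *\<^sub>R v) v"
      by (rule second_difference_mean_value[where f = f and F = F and G = H, OF h in_S' F H])
    have c: "x + a *\<^sub>R w + b *\<^sub>R v = x + b *\<^sub>R v + a *\<^sub>R w" for a b
      by simp
    have "h\<^sup>2 * G (x + s *\<^sub>R v + t *\<^sub>R w) w = h\<^sup>2 * H (x + t' *\<^sub>R v + s' *\<^sub>R w) v"
      using 1(5) 2(5) unfolding c by linarith
    then have "G (x + s *\<^sub>R v + t *\<^sub>R w) w = H (x + t' *\<^sub>R v + s' *\<^sub>R w) v"
      using h by simp
    moreover have "\<bar>G (x + s *\<^sub>R v + t *\<^sub>R w) w - G x w\<bar> < e / 2"
      using near[OF 1(1-4)] d1(2) by (simp add: d_def)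
    moreover have "\<bar>H (x + t' *\<^sub>R v + s' *\<^sub>R w) v - H x v\<bar> < e / 2"
      using near[OF 2(3,4,1,2)] d2(2) by (simp add: d_def)
    ultimately show ?thesis
      by linarith
  qed
  then have "\<bar>G x w - H x v\<bar> \<le> 0"
    by (rule field_le_epsilon[where y = 0, simplified])
  then show ?thesis
    by simp
qed

lemma C_k_SucD: "C_k (Suc k) S f \<Longrightarrow> C_k k S f"
proof (induction k arbitrary: f)
  case 0
  then show ?case
    by (auto intro!: continuous_at_imp_continuous_on differentiable_imp_continuous_within)
next
  case (Suc k)
  then show ?case
    by auto
qed

lemma C_2_frechet_derivative_commute:
  fixes f :: "'a::real_normed_vector \<Rightarrow> 'b::euclidean_space"
  assumes S: "open S" "x \<in> S" and f: "C_k 2 S f"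
  shows "frechet_derivative (\<lambda>y. frechet_derivative f (at y) v) (at x) w
       = frechet_derivative (\<lambda>y. frechet_derivative f (at y) w) (at x) v"
proof (rule euclidean_eqI)
  fix b :: 'b assume "b \<in> Basis"
  let ?D = "\<lambda>v y. frechet_derivative f (at y) v"
  have f': "(f has_derivative frechet_derivative f (at y)) (at y)" if "y \<in> S" for y
    using f that by (simp add: numeral_2_eq_2 frechet_derivative_works[symmetric])
  have f'': "((?D v) has_derivative frechet_derivative (?D v) (at y)) (at y)" if "y \<in> S" for y v
    using f that by (simp add: numeral_2_eq_2 frechet_derivative_works[symmetric])
  have "isCont (\<lambda>y. frechet_derivative (?D v) (at y) w) x" for v w
    using f S by (simp add: numeral_2_eq_2 continuous_on_eq_continuous_at)
  then have c: "isCont (\<lambda>y. frechet_derivative (?D v) (at y) w \<bullet> b) x" for v w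
    by (intro continuous_intros)
  show "frechet_derivative (?D v) (at x) w \<bullet> b = frechet_derivative (?D w) (at x) v \<bullet> b"
    by (rule mixed_derivatives_commute[OF S, of "\<lambda>y. f y \<bullet> b" "\<lambda>y h. ?D h y \<bullet> b" v
          "\<lambda>y h. frechet_derivative (?D v) (at y) h \<bullet> b" w
          "\<lambda>y h. frechet_derivative (?D w) (at y) h \<bullet> b"])
      (intro has_derivative_inner_left f' f'' c; assumption)+
qed

section \<open>The algebraic inequality\<close>

lemma norm_mat_1_sq: "(norm (mat 1 :: real^'n^'n))\<^sup>2 = real CARD('n)"
  by (simp add: power2_norm_eq_inner inner_vec_def mat_def if_distrib[of "\<lambda>x. x * x"] cong: if_cong)

text \<open>In this form the Cauchy-Schwarz inequality bounds the squared trace by the dimension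
  times the squared norm.\<close>

lemma trace_eq_inner_mat_1: "trace A = mat 1 \<bullet> (A :: real^'n^'n)"
  by (simp add: trace_def inner_vec_def mat_def if_distrib[of "\<lambda>x. x * _"] cong: if_cong)

text \<open>The pointwise inequality after division by \<open>a\<^sup>2\<close>. Requiring
  \<open>norm N \<le> 1\<close> instead of equality admits \<open>N = 0\<close>, the case of a
  vanishing symmetric gradient.\<close>

lemma divergence_quadratic_form_bound:
  fixes N :: "real^'n^'n" and T :: "'n \<Rightarrow> real^'n^'n" and d :: "real^'n"
  defines "p \<equiv> \<chi> k. N \<bullet> T k" and "\<tau> \<equiv> \<chi> k. trace (T k)" and "G \<equiv> \<Sum>k\<in>UNIV. (norm (T k))\<^sup>2"
  assumes N: "norm N \<le> 1" and \<theta>: "r \<le> \<theta>"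
    and \<delta>: "\<delta> = 1 - real CARD('n) / 8 + 2 * min r 0" "\<delta> > 0"
    and \<kappa>: "\<kappa> = 1 / (2 + real CARD('n) / (2 * \<delta>))"
  shows "\<kappa> * \<delta> / 2 * G + \<kappa> * ((2 *\<^sub>R d - \<tau>) \<bullet> d - G + 2 * \<theta> * ((2 *\<^sub>R d - \<tau>) \<bullet> (N *v p) - p \<bullet> p))
    \<le> (norm (d + \<theta> *\<^sub>R (N *v p)))\<^sup>2"
proof -
  let ?n = "real CARD('n)"
  define m where "m = N *v p"
  define q where "q = d + \<theta> *\<^sub>R m"
  have n: "?n > 0" by simp
  have \<kappa>pos: "\<kappa> > 0"
    using \<delta>(2) n by (simp add: \<kappa> add_pos_pos)
  \<comment> \<open>This is the total coefficient of \<open>q \<bullet> q\<close>: \<open>2\<close>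
    from the identity \<open>e1\<close> and the rest from absorbing
    \<open>\<tau> \<bullet> q\<close>.\<close>
  have "1 / \<kappa> = 2 + ?n / (2 * \<delta>)"
    by (simp add: \<kappa>)
  then have k1: "1 = \<kappa> * (2 + ?n / (2 * \<delta>))"
    using \<kappa>pos by (simp add: field_simps)
  have G0: "G \<ge> 0"
    by (simp add: G_def sum_nonneg)
  have sq: "(A \<bullet> B)\<^sup>2 \<le> (norm A)\<^sup>2 * (norm B)\<^sup>2" for A B :: "real^'n^'n"
    using Cauchy_Schwarz_ineq[of A B] by (simp add: power2_norm_eq_inner)
  have pp: "p \<bullet> p \<le> G"
  proof -
    have "p \<bullet> p = (\<Sum>k\<in>UNIV. (N \<bullet> T k)\<^sup>2)"
      by (simp add: inner_vec_def p_def power2_eq_square)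
    also have "\<dots> \<le> (\<Sum>k\<in>UNIV. (norm (T k))\<^sup>2)"
    proof (rule sum_mono)
      fix k
      have "(norm N)\<^sup>2 \<le> 1"
        using N by (simp add: power_le_one)
      then show "(N \<bullet> T k)\<^sup>2 \<le> (norm (T k))\<^sup>2"
        using sq[of N "T k"] mult_right_mono[of "(norm N)\<^sup>2" 1 "(norm (T k))\<^sup>2"] by simp
    qed
    finally show ?thesis by (simp add: G_def)
  qed
  have tt: "\<tau> \<bullet> \<tau> \<le> ?n * G"
  proof -
    have "\<tau> \<bullet> \<tau> = (\<Sum>k\<in>UNIV. (mat 1 \<bullet> T k)\<^sup>2)"
      unfolding \<tau>_def trace_eq_inner_mat_1 by (subst inner_vec_def) (simp add: power2_eq_square)
    also have "\<dots> \<le> (\<Sum>k\<in>UNIV. ?n * (norm (T k))\<^sup>2)"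
      by (intro sum_mono sq[of "mat 1", unfolded norm_mat_1_sq])
    finally show ?thesis by (simp add: G_def sum_distrib_left)
  qed
  have \<theta>p: "2 * \<theta> * (p \<bullet> p) \<ge> 2 * min r 0 * G"
  proof -
    have "2 * min r 0 * G \<le> 2 * min r 0 * (p \<bullet> p)"
      using pp by (intro mult_left_mono_neg) auto
    also have "\<dots> \<le> 2 * \<theta> * (p \<bullet> p)"
      using \<theta> by (intro mult_right_mono) auto
    finally show ?thesis .
  qed
  \<comment> \<open>The remainder of this square is the source of the term \<open>n / 8\<close> in
    \<open>\<delta>\<close>.\<close>
  have mm: "2 * \<theta>\<^sup>2 * (m \<bullet> m) + \<theta> * (\<tau> \<bullet> m) + (\<tau> \<bullet> \<tau>) / 8 \<ge> 0"
  proof -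
    have "0 \<le> 2 * ((\<theta> *\<^sub>R m + (1/4) *\<^sub>R \<tau>) \<bullet> (\<theta> *\<^sub>R m + (1/4) *\<^sub>R \<tau>))"
      by simp
    then show ?thesis
      by (simp add: inner_simps inner_commute power2_eq_square algebra_simps)
  qed
  \<comment> \<open>The weights are such that, by \<open>tt\<close>, the last term costs only half
    of \<open>\<delta> * G\<close>; the other half remains as the gradient term of the
    claim.\<close>
  have tq: "?n / (2 * \<delta>) * (q \<bullet> q) + \<tau> \<bullet> q + \<delta> / (2 * ?n) * (\<tau> \<bullet> \<tau>) \<ge> 0"
  proof -
    define c where "c = ?n / (2 * \<delta>)"
    have c: "c > 0" using n \<delta>(2) by (simp add: c_def)
    have e: "\<delta> / (2 * ?n) = 1 / (4 * c)"
      using n \<delta>(2) by (simp add: c_def field_simps)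
    have "0 \<le> c * ((q + (1 / (2 * c)) *\<^sub>R \<tau>) \<bullet> (q + (1 / (2 * c)) *\<^sub>R \<tau>))"
      using c by simp
    also have "\<dots> = c * (q \<bullet> q) + \<tau> \<bullet> q + 1 / (4 * c) * (\<tau> \<bullet> \<tau>)"
      using c by (simp add: inner_simps inner_commute field_simps)
    finally show ?thesis
      by (simp only: e c_def[symmetric])
  qed
  have "\<delta> / (2 * ?n) * (\<tau> \<bullet> \<tau>) \<le> \<delta> / (2 * ?n) * (?n * G)"
    using tt \<delta>(2) n by (intro mult_left_mono) auto
  then have tq': "?n / (2 * \<delta>) * (q \<bullet> q) + \<tau> \<bullet> q + \<delta> / 2 * G \<ge> 0"
    using tq n by simp
  have dq: "d = q - \<theta> *\<^sub>R m"
    by (simp add: q_def)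
  have e1: "(2 *\<^sub>R d - \<tau>) \<bullet> d + 2 * \<theta> * ((2 *\<^sub>R d - \<tau>) \<bullet> m)
      = 2 * (q \<bullet> q) - 2 * \<theta>\<^sup>2 * (m \<bullet> m) - \<tau> \<bullet> q - \<theta> * (\<tau> \<bullet> m)"
    by (simp add: dq inner_simps inner_commute power2_eq_square algebra_simps)
  have "0 \<le> ?n / (2 * \<delta>) * (q \<bullet> q) + \<tau> \<bullet> q + \<delta> / 2 * G
      + (2 * \<theta> * (p \<bullet> p) - 2 * min r 0 * G)
      + (2 * \<theta>\<^sup>2 * (m \<bullet> m) + \<theta> * (\<tau> \<bullet> m) + (\<tau> \<bullet> \<tau>) / 8) + (?n * G - \<tau> \<bullet> \<tau>) / 8"
    using tq' \<theta>p mm tt by simp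
  also have "\<dots> = (2 + ?n / (2 * \<delta>)) * (q \<bullet> q) - (\<delta> / 2 * G
      + ((2 *\<^sub>R d - \<tau>) \<bullet> d - G + 2 * \<theta> * ((2 *\<^sub>R d - \<tau>) \<bullet> m - p \<bullet> p)))"
  proof -
    have "\<delta> * G = G - ?n * G / 8 + 2 * min r 0 * G"
      by (simp add: \<delta>(1) left_diff_distrib distrib_right)
    moreover have "2 * \<theta> * ((2 *\<^sub>R d - \<tau>) \<bullet> m - p \<bullet> p)
        = 2 * \<theta> * ((2 *\<^sub>R d - \<tau>) \<bullet> m) - 2 * \<theta> * (p \<bullet> p)"
      by (rule right_diff_distrib)
    moreover have "(2 + ?n / (2 * \<delta>)) * (q \<bullet> q) = 2 * (q \<bullet> q) + ?n / (2 * \<delta>) * (q \<bullet> q)"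
      by (rule distrib_right)
    ultimately show ?thesis
      using e1 by argo
  qed
  finally have "0 \<le> \<kappa> * ((2 + ?n / (2 * \<delta>)) * (q \<bullet> q) - (\<delta> / 2 * G
      + ((2 *\<^sub>R d - \<tau>) \<bullet> d - G + 2 * \<theta> * ((2 *\<^sub>R d - \<tau>) \<bullet> m - p \<bullet> p))))"
    using \<kappa>pos by simp
  also have "\<dots> = q \<bullet> q - (\<kappa> * \<delta> / 2 * G
      + \<kappa> * ((2 *\<^sub>R d - \<tau>) \<bullet> d - G + 2 * \<theta> * ((2 *\<^sub>R d - \<tau>) \<bullet> m - p \<bullet> p)))"
    using k1 by (simp only: right_diff_distrib distrib_left mult.assoc[symmetric]) simp
  finally show ?thesis
    by (simp add: power2_norm_eq_inner q_def m_def)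
qed

section \<open>Composition of \<open>a\<close> with a norm\<close>

text \<open>Away from \<open>0\<close>, \<open>a\<close> is the quotient of the differentiable
  function \<open>b_fun a\<close> by the identity.\<close>

lemma ext0_has_derivative:
  assumes b: "C1_on_nonneg (b_fun a)" and t: "t > 0"
  shows "(ext0 a has_real_derivative deriv a t) (at t)"
proof -
  obtain b' where b': "(b_fun a has_real_derivative b' t) (at t within {0..})"
    using b t unfolding C1_on_nonneg_def by (meson less_imp_le)
  have "t \<in> interior {0..}"
    using t by simp
  then have "(b_fun a has_real_derivative b' t) (at t)"
    using b' at_within_interior by metis
  then have b_over: "((\<lambda>s. b_fun a s / s) has_real_derivative (b' t * t - b_fun a t * 1) / (t * t)) (at t)"
    using t by (intro DERIV_divide) auto
  have "(a has_real_derivative (b' t * t - b_fun a t * 1) / (t * t)) (at t)"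
    by (rule has_field_derivative_transform_within_open[OF b_over, of "{0<..}"])
      (use t in \<open>auto simp: b_fun_def\<close>)
  then have "(a has_real_derivative deriv a t) (at t)"
    using DERIV_imp_deriv[of a] by simp
  then show ?thesis
    by (rule has_field_derivative_transform_within_open[of _ _ _ "{0<..}"])
      (use t in \<open>auto simp: ext0_def\<close>)
qed

text \<open>Since \<open>b_fun a\<close> vanishes at \<open>0\<close>, its difference quotient there
  is \<open>a\<close> itself, with limit the one-sided derivative.\<close>

lemma continuous_ext0_at_0:
  assumes b: "C1_on_nonneg (b_fun a)"
  shows "continuous (at 0 within {0..}) (ext0 a)"
proof -
  obtain b0 where b0: "(b_fun a has_real_derivative b0) (at 0 within {0..})"
    using b unfolding C1_on_nonneg_def by (meson order_refl)
  then have "vector_derivative (b_fun a) (at 0 within {0..}) = b0"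
    by (intro vector_derivative_within)
       (auto simp: has_real_derivative_iff_has_vector_derivative at_within_Ici_at_right)
  then have "ext0 a 0 = b0"
    by (simp add: ext0_def)
  moreover have "((\<lambda>s. (b_fun a s - b_fun a 0) / (s - 0)) \<longlongrightarrow> b0) (at 0 within {0..})"
    using b0 by (simp add: has_field_derivative_iff)
  moreover have ev: "\<forall>\<^sub>F s in at 0 within {0..}. (b_fun a s - b_fun a 0) / (s - 0) = ext0 a s"
    by (auto simp: eventually_at_filter b_fun_def ext0_def)
  ultimately show ?thesis
    unfolding continuous_within tendsto_cong[OF ev] by simp
qed

text \<open>Near \<open>x\<close>, \<open>f\<close> is at most a constant times the distance to
  \<open>x\<close>, so continuity of \<open>g\<close> makes \<open>(g y - g x) * f y\<close> of
  smaller order than that distance.\<close>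

lemma has_derivative_mult_vanishing:
  fixes f g :: "'a::real_normed_vector \<Rightarrow> real"
  assumes f: "(f has_derivative f') (at x)" "f x = 0" and g: "isCont g x"
  shows "((\<lambda>y. g y * f y) has_derivative (\<lambda>h. g x * f' h)) (at x)"
proof -
  obtain B where B: "\<And>h. norm (f' h) \<le> norm h * B"
    using f(1) has_derivative_bounded_linear bounded_linear.bounded by metis
  obtain e where e: "e > 0" "\<And>y. norm (y - x) < e \<Longrightarrow>
      norm (f y - f x - f' (y - x)) \<le> 1 * norm (y - x)"
    using f(1) unfolding has_derivative_at_alt by (metis zero_less_one)
  have K: "\<bar>f y\<bar> \<le> (B + 1) * norm (y - x)" if "dist y x < e" for y
    using e(2)[of y] B[of "y - x"] that f(2) by (simp add: dist_norm algebra_simps)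
  have "((\<lambda>y. (g y - g x) * f y) has_derivative (\<lambda>h. 0)) (at x)"
  proof (rule has_derivativeI_sandwich[OF e(1)])
    show "bounded_linear (\<lambda>h::'a. 0::real)" by (rule bounded_linear_zero)
    show "norm ((g y - g x) * f y - (g x - g x) * f x - 0) / norm (y - x) \<le> \<bar>g y - g x\<bar> * (B + 1)"
      if "y \<noteq> x" "dist y x < e" for y
      using mult_left_mono[OF K[OF that(2)], of "\<bar>g y - g x\<bar>"] that(1)
      by (simp add: abs_mult divide_le_eq mult.assoc)
    have "((\<lambda>y. \<bar>g y - g x\<bar> * (B + 1)) \<longlongrightarrow> \<bar>g x - g x\<bar> * (B + 1)) (at x)"
      using g unfolding isCont_def by (intro tendsto_intros)
    then show "((\<lambda>y. \<bar>g y - g x\<bar> * (B + 1)) \<longlongrightarrow> 0) (at x)"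
      by simp
  qed
  from has_derivative_add[OF this has_derivative_mult_right[OF f(1), of "g x"]]
  show ?thesis
    by (simp add: algebra_simps)
qed

text \<open>
  If \<open>E x = 0\<close>, then \<open>sgn (E x)\<close> and \<open>f x / norm (E x)\<close> are \<open>0\<close>, and the formula holds although
  \<open>y \<mapsto> ext0 a (norm (E y))\<close> may fail to be differentiable at \<open>x\<close>.
\<close>

lemma ext0_norm_product_rule:
  fixes E :: "'a::real_normed_vector \<Rightarrow> 'b::real_inner"
  assumes b: "C1_on_nonneg (b_fun a)" and a: "\<And>t. t > 0 \<Longrightarrow> a t > 0"
    and r: "\<And>t. t > 0 \<Longrightarrow> r \<le> t * deriv a t / a t"
    and E: "(E has_derivative E') (at x)"
  obtains \<theta> where "min r 0 \<le> \<theta>"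
    and "\<And>f f'. \<lbrakk>(f has_derivative f') (at x); E x = 0 \<Longrightarrow> f x = 0\<rbrakk> \<Longrightarrow>
      ((\<lambda>y. ext0 a (norm (E y)) * f y) has_derivative
        (\<lambda>h. ext0 a (norm (E x)) * (f' h + \<theta> * (sgn (E x) \<bullet> E' h) * (f x / norm (E x))))) (at x)"
proof (cases "E x = 0")
  case True
  have "continuous (at (norm (E x)) within range (\<lambda>y. norm (E y))) (ext0 a)"
    by (rule continuous_within_subset[of _ "{0..}"]) (use continuous_ext0_at_0[OF b] True in auto)
  moreover have "isCont (\<lambda>y. norm (E y)) x"
    using has_derivative_continuous[OF E] by (intro continuous_intros)
  ultimately have "isCont (\<lambda>y. ext0 a (norm (E y))) x"
    using continuous_within_compose[of x UNIV "\<lambda>y. norm (E y)" "ext0 a"] unfolding o_def by blast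
  then have "((\<lambda>y. ext0 a (norm (E y)) * f y) has_derivative
        (\<lambda>h. ext0 a (norm (E x)) * f' h)) (at x)" if "(f has_derivative f') (at x)" "f x = 0" for f f'
    using has_derivative_mult_vanishing that by blast
  \<comment> \<open>The choice \<open>\<theta> = 0\<close> here is the reason for the bound
    \<open>min r 0\<close> instead of \<open>r\<close>.\<close>
  then show ?thesis
    using that[of 0] True by simp
next
  case False
  define t where "t = norm (E x)"
  have t: "t > 0" using False by (simp add: t_def)
  define \<theta> where "\<theta> = t * deriv a t / a t"
  have at: "ext0 a t = a t" "a t > 0" using t a by (auto simp: ext0_def)
  have "((\<lambda>y. norm (E y)) has_derivative (\<lambda>h. sgn (E x) \<bullet> E' h)) (at x)"
    by (rule has_derivative_eq_rhs[OF has_derivative_compose[OF E has_derivative_norm]])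
      (use False in \<open>auto simp: inner_commute\<close>)
  then have \<alpha>: "((\<lambda>y. ext0 a (norm (E y))) has_derivative (\<lambda>h. deriv a t * (sgn (E x) \<bullet> E' h))) (at x)"
    using has_derivative_compose[where g = "ext0 a" and g' = "(*) (deriv a t)"]
      ext0_has_derivative[OF b t] unfolding has_field_derivative_def t_def by blast
  have d: "deriv a t = a t * \<theta> / t"
    using t at by (simp add: \<theta>_def)
  show ?thesis
  proof (rule that[of \<theta>])
    show "min r 0 \<le> \<theta>" using r[OF t] by (simp add: \<theta>_def)
    fix f :: "'a \<Rightarrow> real" and f' assume "(f has_derivative f') (at x)"
    from has_derivative_mult[OF \<alpha> this]
    show "((\<lambda>y. ext0 a (norm (E y)) * f y) has_derivative
        (\<lambda>h. ext0 a (norm (E x)) * (f' h + \<theta> * (sgn (E x) \<bullet> E' h) * (f x / norm (E x))))) (at x)"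
      by (rule has_derivative_eq_rhs) (auto simp: t_def[symmetric] at(1) d algebra_simps)
  qed
qed

section \<open>Derivatives of the symmetric gradient\<close>

lemma has_derivative_vec_lambda:
  fixes f :: "'a::real_normed_vector \<Rightarrow> 'n::finite \<Rightarrow> 'b::euclidean_space"
  assumes "\<And>i. ((\<lambda>y. f y i) has_derivative (\<lambda>h. f' h i)) (at x within S)"
  shows "((\<lambda>y. \<chi> i. f y i) has_derivative (\<lambda>h. \<chi> i. f' h i)) (at x within S)"
  unfolding has_derivative_componentwise_within[of "\<lambda>y. \<chi> i. f y i"]
  by (auto simp: Basis_vec_def inner_axis intro!: has_derivative_inner_left assms)

text \<open>The formula for \<open>V\<close> is asked for on a neighbourhood only, because those for
  the Laplacian and the gradient hold only where \<open>u\<close> is smooth.\<close>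

lemma divergence_eqI:
  fixes V :: "real^'n \<Rightarrow> real^'n"
  assumes S: "open S" "x \<in> S" and V: "\<And>y k. y \<in> S \<Longrightarrow> V y $ k = W k y"
    and W: "\<And>k. (W k has_derivative W' k) (at x)"
  shows "divergence V x = (\<Sum>k\<in>UNIV. W' k (axis k 1))"
proof -
  have "((\<lambda>y. \<chi> k. W k y) has_derivative (\<lambda>h. \<chi> k. W' k h)) (at x)"
    by (intro has_derivative_vec_lambda W)
  then have "(V has_derivative (\<lambda>h. \<chi> k. W' k h)) (at x)"
    by (rule has_derivative_transform_within_open[OF _ S]) (simp add: vec_eq_iff V)
  then show ?thesis
    by (simp add: divergence_def jacobian_def matrix_def trace_def frechet_derivative_at[symmetric])
qed

text \<open>The symmetric part of the matrix with columns \<open>F j\<close>. Columns are used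
  because partial derivatives of \<open>u\<close> are the columns of its Jacobian.\<close>

definition symmetrized :: "('n \<Rightarrow> real^'n) \<Rightarrow> real^'n^'n" where
  "symmetrized F = (\<chi> i j. (F j $ i + F i $ j) / 2)"

lemma has_derivative_symmetrized:
  assumes "\<And>j. (F j has_derivative F' j) (at x)"
  shows "((\<lambda>y. symmetrized (\<lambda>j. F j y)) has_derivative (\<lambda>h. symmetrized (\<lambda>j. F' j h))) (at x)"
proof -
  have "((\<lambda>y. F j y $ i) has_derivative (\<lambda>h. F' j h $ i)) (at x)" for i j
    using bounded_linear.has_derivative[OF bounded_linear_vec_nth assms] .
  then show ?thesis
    unfolding symmetrized_def
    by (intro has_derivative_vec_lambda) (auto intro!: derivative_eq_intros)
qed

lemma symmetrized_sum: "(\<Sum>k\<in>A. symmetrized (F k)) = symmetrized (\<lambda>j. \<Sum>k\<in>A. F k j)"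
  by (simp add: symmetrized_def vec_eq_iff sum.distrib flip: sum_divide_distrib)

text \<open>A symmetric matrix is orthogonal to skew ones, so the second factor may be replaced by
  the matrix with columns \<open>G j\<close>.\<close>

lemma inner_symmetrized:
  "symmetrized F \<bullet> symmetrized G = (\<Sum>i\<in>UNIV. \<Sum>j\<in>UNIV. G j $ i * symmetrized F $ i $ j)"
proof -
  let ?S = "symmetrized F"
  have "(\<Sum>i\<in>UNIV. \<Sum>j\<in>UNIV. G i $ j * ?S $ i $ j) = (\<Sum>i\<in>UNIV. \<Sum>j\<in>UNIV. G j $ i * ?S $ i $ j)"
    by (subst sum.swap) (simp add: symmetrized_def add.commute)
  moreover have "?S \<bullet> symmetrized G = ((\<Sum>i\<in>UNIV. \<Sum>j\<in>UNIV. G j $ i * ?S $ i $ j)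
      + (\<Sum>i\<in>UNIV. \<Sum>j\<in>UNIV. G i $ j * ?S $ i $ j)) / 2"
    by (simp add: inner_vec_def symmetrized_def[of G] sum.distrib[symmetric] sum_divide_distrib algebra_simps)
  ultimately show ?thesis by simp
qed

lemma sym_grad_eq_symmetrized:
  "sym_grad u y = symmetrized (\<lambda>j. frechet_derivative u (at y) (axis j 1))"
  by (simp add: sym_grad_def symmetrized_def jacobian_def matrix_def transpose_def vec_eq_iff)

lemma A_map_eq_ext0: "A_map a \<xi> = ext0 a (norm \<xi>) *\<^sub>R \<xi>"
  by (simp add: A_map_def ext0_def)

text \<open>\<open>frechet_derivative\<close> chooses among all derivatives at the point, so it is
  enough that both functions have the same ones.\<close>

lemma frechet_derivative_cong_open:
  assumes "open S" "x \<in> S" "\<And>y. y \<in> S \<Longrightarrow> f y = g y"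
  shows "frechet_derivative f (at x) = frechet_derivative g (at x)"
proof -
  have "(f has_derivative f') (at x) \<longleftrightarrow> (g has_derivative f') (at x)" for f'
    using has_derivative_transform_within_open[OF _ assms(1,2)] assms(3) by metis
  then show ?thesis
    by (simp add: frechet_derivative_def)
qed

lemma vec_laplacian_eq:
  fixes u :: "real^'n \<Rightarrow> real^'n"
  assumes S: "open S" "y \<in> S" and u: "C_k 2 S u"
  shows "vec_laplacian u y = (\<Sum>j\<in>UNIV. frechet_derivative
    (\<lambda>z. frechet_derivative u (at z) (axis j 1)) (at y) (axis j 1))"
proof -
  have d: "(u has_derivative frechet_derivative u (at z)) (at z)"
    "((\<lambda>z. frechet_derivative u (at z) v) has_derivative
       frechet_derivative (\<lambda>z. frechet_derivative u (at z) v) (at z)) (at z)" if "z \<in> S" for z v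
    using u that by (simp_all add: numeral_2_eq_2 frechet_derivative_works[symmetric])
  have "laplacian (\<lambda>z. u z $ i) y = (\<Sum>j\<in>UNIV. frechet_derivative
    (\<lambda>z. frechet_derivative u (at z) (axis j 1)) (at y) (axis j 1) $ i)" for i
    unfolding laplacian_def
  proof (rule divergence_eqI[OF S, where W' = "\<lambda>k h. frechet_derivative
        (\<lambda>z. frechet_derivative u (at z) (axis k 1)) (at y) h $ i"])
    show "grad (\<lambda>z. u z $ i) z $ k = frechet_derivative u (at z) (axis k 1) $ i" if "z \<in> S" for z k
      unfolding grad_def
      by (simp add: frechet_derivative_at[OF bounded_linear.has_derivative[OF bounded_linear_vec_nth d(1)[OF that]], symmetric])
    show "((\<lambda>z. frechet_derivative u (at z) (axis k 1) $ i) has_derivative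
       (\<lambda>h. frechet_derivative (\<lambda>z. frechet_derivative u (at z) (axis k 1)) (at y) h $ i)) (at y)" for k
      using bounded_linear.has_derivative[OF bounded_linear_vec_nth d(2)[OF S(2)]] .
  qed
  then show ?thesis
    by (simp add: vec_laplacian_def vec_eq_iff)
qed

text \<open>Both sides are computed explicitly at \<open>x\<close>, which reduces the claim to
  \<open>divergence_quadratic_form_bound\<close> times the square of
  \<open>ext0 a (norm (E x))\<close>.\<close>

lemma sym_grad_divergence_inequality:
  fixes u :: "real^'n \<Rightarrow> real^'n"
  defines "E \<equiv> sym_grad u"
  assumes S: "open S" "x \<in> S" and u: "C_k 3 S u"
    and b: "C1_on_nonneg (b_fun a)" and a: "\<And>t. t > 0 \<Longrightarrow> a t > 0"
    and r: "\<And>t. t > 0 \<Longrightarrow> r \<le> t * deriv a t / a t"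
    and \<delta>: "\<delta> = 1 - real CARD('n) / 8 + 2 * min r 0" "\<delta> > 0"
    and \<kappa>: "\<kappa> = 1 / (2 + real CARD('n) / (2 * \<delta>))"
  shows "\<kappa> * \<delta> / 2 * (ext0 a (norm (E x)))\<^sup>2 * (norm (mat_grad E x))\<^sup>2
      + \<kappa> * divergence (\<lambda>y. (ext0 a (norm (E y)))\<^sup>2 *\<^sub>R
          (vec_laplacian u y v* E y - (1/2) *\<^sub>R grad (\<lambda>z. (norm (E z))\<^sup>2) y)) x
    \<le> (norm (mat_divergence (\<lambda>y. A_map a (E y)) x))\<^sup>2"
proof -

  \<comment> \<open>Partial derivatives of \<open>u\<close> up to order three and their
    symmetries\<close>
  define D where "D j y = frechet_derivative u (at y) (axis j 1)" for j y
  define D2 where "D2 j k y = frechet_derivative (D j) (at y) (axis k 1)" for j k y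
  define D3 where "D3 j k l = frechet_derivative (D2 j k) (at x) (axis l 1)" for j k l
  have C3u: "C_k (Suc 2) S u"
    using u by (simp only: numeral_3_eq_3 numeral_2_eq_2)
  then have C2u: "C_k 2 S u"
    by (rule C_k_SucD)
  have C2D: "C_k 2 S (D j)" for j
    unfolding D_def[abs_def] using C3u by (simp only: C_k.simps(2))
  have dD: "(D j has_derivative frechet_derivative (D j) (at y)) (at y)" if "y \<in> S" for j y
    using C2D that by (simp add: numeral_2_eq_2 frechet_derivative_works[symmetric])
  have dD2: "(D2 j k has_derivative frechet_derivative (D2 j k) (at y)) (at y)" if "y \<in> S" for j k y
    unfolding D2_def[abs_def] frechet_derivative_works[symmetric]
    using C2D[of j] that by (simp add: numeral_2_eq_2)
  have D2_commute: "D2 j k y = D2 k j y" if "y \<in> S" for j k y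
    using C_2_frechet_derivative_commute[OF S(1) that C2u] unfolding D2_def D_def[abs_def] by blast
  \<comment> \<open>The first two indices commute on all of \<open>S\<close>, so the identity can be
    differentiated once more.\<close>
  have D3_commute12: "D3 j k l = D3 k j l" for j k l
    using frechet_derivative_cong_open[OF S, of "D2 j k" "D2 k j"] D2_commute unfolding D3_def by metis
  have D3_commute23: "D3 j k l = D3 j l k" for j k l
    using C_2_frechet_derivative_commute[OF S C2D] unfolding D3_def D2_def[abs_def] by blast

  define L where "L y = (\<Sum>j\<in>UNIV. D2 j j y)" for y
  have L: "vec_laplacian u y = L y" if "y \<in> S" for y
    using vec_laplacian_eq[OF S(1) that C2u] unfolding L_def D2_def D_def[abs_def] .
  have E_eq: "E = (\<lambda>y. symmetrized (\<lambda>j. D j y))"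
    by (simp add: fun_eq_iff E_def sym_grad_eq_symmetrized D_def)
  define E' where "E' y h = symmetrized (\<lambda>j. frechet_derivative (D j) (at y) h)" for y h
  define T where "T k y = symmetrized (\<lambda>j. D2 j k y)" for k y
  define T' where "T' k h = symmetrized (\<lambda>j. frechet_derivative (D2 j k) (at x) h)" for k h
  have E': "(E has_derivative E' y) (at y)" if "y \<in> S" for y
    unfolding E_eq E'_def by (intro has_derivative_symmetrized dD that)
  have E'_axis: "E' y (axis k 1) = T k y" for y k
    by (simp add: E'_def T_def D2_def)
  have T': "(T k has_derivative T' k) (at x)" for k
    unfolding T_def T'_def by (intro has_derivative_symmetrized dD2 S)
  define L' where "L' h = (\<Sum>j\<in>UNIV. frechet_derivative (D2 j j) (at x) h)" for h
  have L': "(L has_derivative L') (at x)"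
    unfolding L_def L'_def by (intro has_derivative_sum dD2 S)
  have nth: "((\<lambda>y. f y $ i) has_derivative (\<lambda>h. f' h $ i)) (at y)"
    if "(f has_derivative f') (at y)" for f :: "real^'n \<Rightarrow> 'b::euclidean_space^'n" and f' i y
    using bounded_linear.has_derivative[OF bounded_linear_vec_nth that] .

  \<comment> \<open>Product rules for the scalar coefficient\<close>
  define \<alpha> where "\<alpha> y = ext0 a (norm (E y))" for y
  define N where "N = sgn (E x)"
  obtain \<theta> where \<theta>: "min r 0 \<le> \<theta>"
    and \<alpha>_mult: "\<And>f f'. \<lbrakk>(f has_derivative f') (at x); E x = 0 \<Longrightarrow> f x = 0\<rbrakk> \<Longrightarrow>
      ((\<lambda>y. \<alpha> y * f y) has_derivative
        (\<lambda>h. \<alpha> x * (f' h + \<theta> * (N \<bullet> E' x h) * (f x / norm (E x))))) (at x)"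
    using ext0_norm_product_rule[OF b a r E'[OF S(2)]] unfolding \<alpha>_def N_def by blast
  have \<alpha>2_mult: "((\<lambda>y. (\<alpha> y)\<^sup>2 * f y) has_derivative
        (\<lambda>h. (\<alpha> x)\<^sup>2 * (f' h + 2 * \<theta> * (N \<bullet> E' x h) * (f x / norm (E x))))) (at x)"
    if "(f has_derivative f') (at x)" "E x = 0 \<Longrightarrow> f x = 0" for f f'
  proof -
    \<comment> \<open>Applying \<open>\<alpha>_mult\<close> twice doubles the
      \<open>\<theta>\<close> term.\<close>
    have "((\<lambda>y. \<alpha> y * (\<alpha> y * f y)) has_derivative
        (\<lambda>h. \<alpha> x * (\<alpha> x * (f' h + \<theta> * (N \<bullet> E' x h) * (f x / norm (E x)))
          + \<theta> * (N \<bullet> E' x h) * (\<alpha> x * f x / norm (E x))))) (at x)"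
      using that by (intro \<alpha>_mult) auto
    then show ?thesis
      by (simp add: power2_eq_square algebra_simps)
  qed

  \<comment> \<open>The algebraic quantities at \<open>x\<close>\<close>
  define d where "d = (\<chi> i. \<Sum>k\<in>UNIV. T k x $ i $ k)"
  define p where "p = (\<chi> k. N \<bullet> T k x)"
  define \<tau> where "\<tau> = (\<chi> k. trace (T k x))"
  define G where "G = (\<Sum>k\<in>UNIV. (norm (T k x))\<^sup>2)"
  \<comment> \<open>For \<open>E x = 0\<close> both sides are \<open>0\<close>, by the conventions
    for division by zero and for \<open>sgn 0\<close>.\<close>
  have N_nth: "E x $ i $ k / norm (E x) = N $ i $ k" for i k
    by (simp add: N_def sgn_div_norm divide_inverse mult.commute)
  have Lx: "L x = 2 *\<^sub>R d - \<tau>"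
  proof -
    have "2 * d $ i - \<tau> $ i = (\<Sum>k\<in>UNIV. D2 k k x $ i + D2 i k x $ k - D2 k i x $ k)" for i
      by (simp add: d_def \<tau>_def trace_def T_def symmetrized_def sum_distrib_left sum_subtractf add_divide_distrib)
    then show ?thesis
      using D2_commute[OF S(2)] by (simp add: vec_eq_iff L_def)
  qed
  have G: "(norm (mat_grad E x))\<^sup>2 = G"
  proof -
    have 1: "frechet_derivative (\<lambda>y. E y $ i) (at x) h = E' x h $ i" for i h
      using frechet_derivative_at[OF nth[OF E'[OF S(2)]]] by metis
    have "(norm (mat_grad E x))\<^sup>2 = (\<Sum>i\<in>UNIV. \<Sum>j\<in>UNIV. \<Sum>k\<in>UNIV. (T k x $ i $ j)\<^sup>2)"
      unfolding power2_norm_eq_inner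
      by (simp add: inner_vec_def mat_grad_def jacobian_def matrix_def 1 E'_axis power2_eq_square)
    also have "\<dots> = (\<Sum>i\<in>UNIV. \<Sum>k\<in>UNIV. \<Sum>j\<in>UNIV. (T k x $ i $ j)\<^sup>2)"
      by (intro sum.cong refl sum.swap)
    also have "\<dots> = (\<Sum>k\<in>UNIV. \<Sum>i\<in>UNIV. \<Sum>j\<in>UNIV. (T k x $ i $ j)\<^sup>2)"
      by (rule sum.swap)
    also have "\<dots> = G"
      unfolding G_def power2_norm_eq_inner by (simp add: inner_vec_def power2_eq_square)
    finally show ?thesis .
  qed

  \<comment> \<open>The divergence on the left-hand side\<close>
  have lhs: "mat_divergence (\<lambda>y. A_map a (E y)) x = \<alpha> x *\<^sub>R (d + \<theta> *\<^sub>R (N *v p))"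
  proof -
    have "divergence (\<lambda>y. A_map a (E y) $ i) x
        = (\<Sum>k\<in>UNIV. \<alpha> x * (E' x (axis k 1) $ i $ k
            + \<theta> * (N \<bullet> E' x (axis k 1)) * (E x $ i $ k / norm (E x))))" for i
    proof (rule divergence_eqI[OF S, where W = "\<lambda>k y. \<alpha> y * E y $ i $ k"
          and W' = "\<lambda>k h. \<alpha> x * (E' x h $ i $ k + \<theta> * (N \<bullet> E' x h) * (E x $ i $ k / norm (E x)))"])
      show "((\<lambda>y. \<alpha> y * E y $ i $ k) has_derivative (\<lambda>h. \<alpha> x * (E' x h $ i $ k
          + \<theta> * (N \<bullet> E' x h) * (E x $ i $ k / norm (E x))))) (at x)" for k
        by (rule \<alpha>_mult) (auto intro!: nth E' S)
    qed (simp add: A_map_eq_ext0 \<alpha>_def)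
    then show ?thesis
      by (simp add: mat_divergence_def vec_eq_iff E'_axis N_nth d_def p_def matrix_vector_mult_def
          sum.distrib sum_distrib_left algebra_simps)
  qed

  \<comment> \<open>The divergence term on the right-hand side\<close>
  define P where "P k y = (\<Sum>i\<in>UNIV. L y $ i * E y $ i $ k) - E y \<bullet> T k y" for k y
  define P' where "P' k h = (\<Sum>i\<in>UNIV. L x $ i * E' x h $ i $ k + L' h $ i * E x $ i $ k)
      - (E x \<bullet> T' k h + E' x h \<bullet> T k x)" for k h
  \<comment> \<open>\<open>P k\<close> is the \<open>k\<close>-th component of the field without the
    factor \<open>\<alpha>\<^sup>2\<close>. It vanishes wherever \<open>E\<close> does, as
    \<open>\<alpha>2_mult\<close> requires.\<close>
  have P': "(P k has_derivative P' k) (at x)" for k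
    unfolding P_def P'_def
    by (intro has_derivative_diff has_derivative_sum has_derivative_mult has_derivative_inner
        nth E' L' T' S)
  have grad_E: "grad (\<lambda>z. (norm (E z))\<^sup>2) y $ k = 2 * (E y \<bullet> T k y)" if "y \<in> S" for y k
  proof -
    have "((\<lambda>z. (norm (E z))\<^sup>2) has_derivative (\<lambda>h. E y \<bullet> E' y h + E' y h \<bullet> E y)) (at y)"
      unfolding power2_norm_eq_inner by (intro has_derivative_inner E' that)
    then show ?thesis
      by (simp add: grad_def frechet_derivative_at[symmetric] E'_axis inner_commute)
  qed
  have "divergence (\<lambda>y. (\<alpha> y)\<^sup>2 *\<^sub>R
      (vec_laplacian u y v* E y - (1/2) *\<^sub>R grad (\<lambda>z. (norm (E z))\<^sup>2) y)) x
    = (\<Sum>k\<in>UNIV. (\<alpha> x)\<^sup>2 * (P' k (axis k 1)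
        + 2 * \<theta> * (N \<bullet> E' x (axis k 1)) * (P k x / norm (E x))))"
  proof (rule divergence_eqI[OF S, where W = "\<lambda>k y. (\<alpha> y)\<^sup>2 * P k y"
        and W' = "\<lambda>k h. (\<alpha> x)\<^sup>2 * (P' k h + 2 * \<theta> * (N \<bullet> E' x h) * (P k x / norm (E x)))"])
    show "((\<alpha> y)\<^sup>2 *\<^sub>R (vec_laplacian u y v* E y - (1/2) *\<^sub>R grad (\<lambda>z. (norm (E z))\<^sup>2) y)) $ k
        = (\<alpha> y)\<^sup>2 * P k y" if "y \<in> S" for y k
      using that by (simp add: L grad_E P_def vector_matrix_mult_def mult.commute)
    show "((\<lambda>y. (\<alpha> y)\<^sup>2 * P k y) has_derivative
        (\<lambda>h. (\<alpha> x)\<^sup>2 * (P' k h + 2 * \<theta> * (N \<bullet> E' x h) * (P k x / norm (E x))))) (at x)" for k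
      by (rule \<alpha>2_mult[OF P']) (simp add: P_def)
  qed
  also have "\<dots> = (\<alpha> x)\<^sup>2 * ((\<Sum>k\<in>UNIV. P' k (axis k 1))
      + 2 * \<theta> * (\<Sum>k\<in>UNIV. p $ k * (P k x / norm (E x))))"
    by (simp add: E'_axis p_def sum.distrib sum_distrib_left algebra_simps)
  also have "(\<Sum>k\<in>UNIV. p $ k * (P k x / norm (E x))) = L x \<bullet> (N *v p) - p \<bullet> p"
  proof -
    have "P k x / norm (E x) = (\<Sum>i\<in>UNIV. L x $ i * N $ i $ k) - p $ k" for k
      by (simp add: P_def N_nth[symmetric] p_def diff_divide_distrib sum_divide_distrib)
        (simp add: N_def sgn_div_norm divide_inverse mult.commute)
    then have "(\<Sum>k\<in>UNIV. p $ k * (P k x / norm (E x)))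
        = (\<Sum>k\<in>UNIV. \<Sum>i\<in>UNIV. L x $ i * (N $ i $ k * p $ k)) - p \<bullet> p"
      by (simp add: right_diff_distrib sum_subtractf sum_distrib_left inner_vec_def mult_ac)
    also have "(\<Sum>k\<in>UNIV. \<Sum>i\<in>UNIV. L x $ i * (N $ i $ k * p $ k)) = L x \<bullet> (N *v p)"
      by (subst sum.swap) (simp add: inner_vec_def matrix_vector_mult_def sum_distrib_left)
    finally show ?thesis .
  qed
  also have "(\<Sum>k\<in>UNIV. P' k (axis k 1)) = L x \<bullet> d - G"
  proof -
    have L'_axis: "L' (axis l 1) = (\<Sum>k\<in>UNIV. D3 l k k)" for l
    proof -
      have "L' (axis l 1) = (\<Sum>k\<in>UNIV. D3 k k l)"
        by (simp add: L'_def D3_def)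
      also have "\<dots> = (\<Sum>k\<in>UNIV. D3 l k k)"
        using D3_commute12 D3_commute23 by (intro sum.cong) metis+
      finally show ?thesis .
    qed
    \<comment> \<open>The Laplacian of \<open>E\<close> is the symmetric gradient of
      \<open>L\<close>. Paired with \<open>E x\<close>, it equals the sum of the terms of
      \<open>P'\<close> that contain \<open>L'\<close>, so the third derivatives cancel.\<close>
    have "(\<Sum>k\<in>UNIV. T' k (axis k 1)) = symmetrized (\<lambda>j. L' (axis j 1))"
      by (simp add: T'_def symmetrized_sum L'_axis D3_def)
    then have "(\<Sum>k\<in>UNIV. E x \<bullet> T' k (axis k 1))
        = (\<Sum>i\<in>UNIV. \<Sum>k\<in>UNIV. L' (axis k 1) $ i * E x $ i $ k)"
      by (simp add: inner_sum_right[symmetric] E_eq inner_symmetrized)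
    also have "\<dots> = (\<Sum>k\<in>UNIV. \<Sum>i\<in>UNIV. L' (axis k 1) $ i * E x $ i $ k)"
      by (rule sum.swap)
    finally have "(\<Sum>k\<in>UNIV. E x \<bullet> T' k (axis k 1))
        = (\<Sum>k\<in>UNIV. \<Sum>i\<in>UNIV. L' (axis k 1) $ i * E x $ i $ k)" .
    moreover have "(\<Sum>k\<in>UNIV. \<Sum>i\<in>UNIV. L x $ i * T k x $ i $ k) = L x \<bullet> d"
      by (subst sum.swap) (simp add: inner_vec_def d_def sum_distrib_left)
    ultimately show ?thesis
      by (simp add: P'_def E'_axis sum.distrib sum_subtractf G_def power2_norm_eq_inner)
  qed
  finally have div: "divergence (\<lambda>y. (\<alpha> y)\<^sup>2 *\<^sub>R
      (vec_laplacian u y v* E y - (1/2) *\<^sub>R grad (\<lambda>z. (norm (E z))\<^sup>2) y)) x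
    = (\<alpha> x)\<^sup>2 * (L x \<bullet> d - G + 2 * \<theta> * (L x \<bullet> (N *v p) - p \<bullet> p))" .

  \<comment> \<open>The algebraic bound is used with \<open>min r 0\<close> in place of
    \<open>r\<close>, which leaves \<open>\<delta>\<close> unchanged.\<close>
  have "\<kappa> * \<delta> / 2 * G + \<kappa> * (L x \<bullet> d - G + 2 * \<theta> * (L x \<bullet> (N *v p) - p \<bullet> p))
      \<le> (norm (d + \<theta> *\<^sub>R (N *v p)))\<^sup>2"
    unfolding Lx G_def p_def \<tau>_def
    by (rule divergence_quadratic_form_bound[OF _ \<theta> _ \<delta>(2) \<kappa>]) (simp_all add: N_def norm_sgn \<delta>(1))
  from mult_left_mono[OF this zero_le_power2[of "\<alpha> x"]] show ?thesis
    unfolding \<alpha>_def[symmetric] div lhs G norm_scaleR power_mult_distrib power2_abs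
    by (simp add: algebra_simps)
qed

theorem lemma3p5:
  fixes i s :: ereal
  assumes "2 \<le> CARD('n::finite)" and "CARD('n) \<le> 7"
    and "ereal (- ((8 - real CARD('n)) / 16)) < i" and "i \<le> s" and "s < \<infinity>"
  shows "\<exists>c1>0. \<exists>c2>0.
    \<forall>(\<Omega> :: (real^'n) set) (a :: real \<Rightarrow> real) (u :: real^'n \<Rightarrow> real^'n).
      open \<Omega> \<longrightarrow> (\<forall>t>0. a t > 0) \<longrightarrow> C1_on_nonneg (b_fun a) \<longrightarrow>
      lower_index a = i \<longrightarrow> upper_index a = s \<longrightarrow> C_k 3 \<Omega> u \<longrightarrow>
      (\<forall>x\<in>\<Omega>.
        (norm (mat_divergence (\<lambda>y. A_map a (sym_grad u y)) x))\<^sup>2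
          \<ge> c1 * (ext0 a (norm (sym_grad u x)))\<^sup>2 * (norm (mat_grad (sym_grad u) x))\<^sup>2
            + c2 * divergence
                (\<lambda>y. (ext0 a (norm (sym_grad u y)))\<^sup>2 *\<^sub>R
                   (vec_laplacian u y v* sym_grad u y
                    - (1/2) *\<^sub>R grad (\<lambda>z. (norm (sym_grad u z))\<^sup>2) y)) x)"
proof -
  let ?n = "real CARD('n)"
  obtain r where r: "i = ereal r"
    using assms(3-5) by (cases i) auto
  define \<delta> where "\<delta> = 1 - ?n / 8 + 2 * min r 0"
  define \<kappa> where "\<kappa> = 1 / (2 + ?n / (2 * \<delta>))"
  have "?n \<le> 7"
    using assms(2) by simp
  \<comment> \<open>For \<open>r \<ge> 0\<close> this is \<open>n < 8\<close>; for
    \<open>r < 0\<close> it is the hypothesis on \<open>i\<close> multiplied by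
    \<open>2\<close>.\<close>
  then have \<delta>: "\<delta> > 0"
    using assms(3) by (auto simp: \<delta>_def r min_def field_simps)
  then have \<kappa>: "\<kappa> > 0"
    unfolding \<kappa>_def by (intro divide_pos_pos add_pos_nonneg) auto
  have lower: "r \<le> t * deriv a t / a t" if "lower_index a = i" "t > 0" for a t
    using that INF_lower[of t "{0<..}" "\<lambda>t. ereal (t * deriv a t / a t)"]
    by (simp add: lower_index_def r)
  show ?thesis
    \<comment> \<open>Both witnesses are built from \<open>r\<close> and the dimension alone, so
      they precede the choice of \<open>\<Omega>\<close>, \<open>a\<close> and
      \<open>u\<close>.\<close>
    by (intro exI[of _ "\<kappa> * \<delta> / 2"] conjI exI[of _ \<kappa>] allI impI ballI
        sym_grad_divergence_inequality[OF _ _ _ _ _ _ \<delta>_def \<delta> \<kappa>_def])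
      (use \<delta> \<kappa> lower in auto)
qed

end
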